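(* If $S_{\boldsymbol\lambda}$ is a Fredholm weighted shift on a directed tree $\mathcal T=(V,E)$ with weights $\boldsymbol\lambda=\{\lambda_v\}_{v\in V^\circ}$, then the directed tree $\mathcal T$ is Fredholm and $\operatorname{ind}(S_{\boldsymbol\lambda})=\operatorname{ind}(\mathcal T)\le1$.
   Context: A directed tree $\mathcal T=(V,E)$ consists of a nonempty set $V$ (of arbitrary cardinality) of vertices and a set $E\subseteq V\times V\setminus\{(v,v):v\in V\}$ of edges such that: (1) any two distinct vertices $u,v$ are joined by an undirected path, i.e. there are $v_1=u,\dots,v_n=v$ in $V$ ($n\ge 2$) with $(v_j,v_{j+1})\in E$ or $(v_{j+1},v_j)\in E$ for each $j<n$; (2) there is no circuit, i.e. no finite sequence of distinct vertices $u_1,\dots,u_n$ ($n\ge2$) with $(u_j,u_{j+1})\in E$ for $j<n$ and $(u_n,u_1)\in E$; (3) every vertex $v$ that is not a root has a unique vertex $\operatorname{par}(v)$ (its parent) with $(\operatorname{par}(v),v)\in E$; a root is a vertex $v$ for which there is no $u$ with $(u,v)\in E$. A directed tree has at most one root, denoted $\mathrm{root}$ when it exists. $V^\circ$ is $V$ with the root removed (and $V^\circ=V$ if $\mathcal T$ has no root). $\operatorname{Chi}(u)=\{v\in V:(u,v)\in E\}$, $V'=\{u\in V:\operatorname{Chi}(u)\ne\varnothing\}$ and $V_\prec=\{u\in V:\operatorname{card}(\operatorname{Chi}(u))\ge2\}$. The directed tree $\mathcal T$ is called Fredholm if $\operatorname{card}(\operatorname{Chi}(u))<\infty$ for all $u\in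 V$ and $\operatorname{card}(V_\prec)<\infty$. (In this case $\operatorname{card}(V\setminus V')<\infty$.) The index of a Fredholm directed tree is $$\operatorname{ind}(\mathcal T)=\operatorname{card}(V\setminus V')-\varepsilon-\sum_{u\in V'}(\operatorname{card}(\operatorname{Chi}(u))-1),$$ where $\varepsilon=1$ if $\mathcal T$ has a root and $\varepsilon=0$ otherwise. $\ell^2(V)$ is the Hilbert space of square summable complex functions on $V$. For $\boldsymbol\lambda=\{\lambda_v\}_{v\in V^\circ}\subseteq\mathbb C$ and $f\colon V\to\mathbb C$ put $(\Lambda f)(v)=\lambda_v f(\operatorname{par}(v))$ for $v\in V^\circ$ and $(\Lambda f)(\mathrm{root})=0$. The weighted shift $S_{\boldsymbol\lambda}$ is the operator in $\ell^2(V)$ with domain $\{f\in\ell^2(V):\Lambda f\in\ell^2(V)\}$ and $S_{\boldsymbol\lambda}f=\Lambda f$; it is closed. A closed densely defined operator $T$ in a complex Hilbert space is Fredholm if its range is closed and the kernels $\mathcal N(T)$ and $\mathcal N(T^* )$ are finite dimensional; its index is $\operatorname{ind}(T)=\dim\mathcal N(T)-\dim\mathcal N(T^* )$. A Fredholm weighted shift is a densely defined weighted shift that is a Fredholm operator. *)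

theory Defs
  imports "HOL-Analysis.Analysis" "HOL-Library.Function_Algebras"
begin

section \<open>Directed trees\<close>

text \<open>An edge \<open>(u, v)\<close> points from the parent \<open>u\<close> to the child \<open>v\<close>.\<close>

definition roots :: "'a set \<Rightarrow> ('a \<times> 'a) set \<Rightarrow> 'a set" where
  "roots V E = {v \<in> V. \<nexists>u. (u, v) \<in> E}"

locale directed_tree =
  fixes V :: "'a set" and E :: "('a \<times> 'a) set"
  assumes nonempty: "V \<noteq> {}"
    and edges: "E \<subseteq> V \<times> V - {(v, v) |v. v \<in> V}"
    and connected: "\<And>u v. u \<in> V \<Longrightarrow> v \<in> V \<Longrightarrow> u \<noteq> v \<Longrightarrow>
      \<exists>p. length p \<ge> 2 \<and> set p \<subseteq> V \<and> hd p = u \<and> last p = v \<and>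
          successively (\<lambda>x y. (x, y) \<in> E \<or> (y, x) \<in> E) p"
    and no_circuit: "\<nexists>p. length p \<ge> 2 \<and> distinct p \<and>
          successively (\<lambda>x y. (x, y) \<in> E) p \<and> (last p, hd p) \<in> E"
    and unique_parent: "\<And>v. v \<in> V - roots V E \<Longrightarrow> \<exists>!u. (u, v) \<in> E"

definition par :: "('a \<times> 'a) set \<Rightarrow> 'a \<Rightarrow> 'a" where
  "par E v = (THE u. (u, v) \<in> E)"

definition Chi :: "('a \<times> 'a) set \<Rightarrow> 'a \<Rightarrow> 'a set" where
  "Chi E u = {v. (u, v) \<in> E}"

text \<open>The set \<open>V\<degree>\<close>.\<close>

definition nonroots :: "'a set \<Rightarrow> ('a \<times> 'a) set \<Rightarrow> 'a set" where
  "nonroots V E = V - roots V E"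

text \<open>The set \<open>V'\<close>.\<close>

definition nonleaves :: "'a set \<Rightarrow> ('a \<times> 'a) set \<Rightarrow> 'a set" where
  "nonleaves V E = {u \<in> V. Chi E u \<noteq> {}}"

text \<open>The set \<open>V\<^sub>\<prec>\<close>. The cardinality of an infinite set is \<open>0\<close> in HOL, so vertices with
  infinitely many children have to be listed separately.\<close>

definition branching :: "'a set \<Rightarrow> ('a \<times> 'a) set \<Rightarrow> 'a set" where
  "branching V E = {u \<in> V. infinite (Chi E u) \<or> card (Chi E u) \<ge> 2}"

definition fredholm_tree :: "'a set \<Rightarrow> ('a \<times> 'a) set \<Rightarrow> bool" where
  "fredholm_tree V E \<longleftrightarrow> (\<forall>u\<in>V. finite (Chi E u)) \<and> finite (branching V E)"

text \<open>The sum over \<open>V'\<close> in the index has finitely many nonzero terms, but \<open>V'\<close> may be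
  infinite and HOL's \<open>sum\<close> is \<open>0\<close> on infinite sets; hence the restriction to the nonzero terms.\<close>

definition tree_index :: "'a set \<Rightarrow> ('a \<times> 'a) set \<Rightarrow> int" where
  "tree_index V E =
     int (card (V - nonleaves V E)) - (if roots V E \<noteq> {} then 1 else 0)
       - (\<Sum>u\<in>{u \<in> nonleaves V E. int (card (Chi E u)) - 1 \<noteq> 0}. int (card (Chi E u)) - 1)"

section \<open>The Hilbert space of square summable functions on a set\<close>

text \<open>A function on \<open>V\<close> is represented by its extension by \<open>0\<close> outside \<open>V\<close>, so that the vector
  space operations are the pointwise ones.\<close>

global_interpretation cfun: vector_space "\<lambda>(c::complex) (f :: 'a \<Rightarrow> complex) v. c * f v"
  by unfold_locales (auto simp: fun_eq_iff algebra_simps)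

definition ell2 :: "'a set \<Rightarrow> ('a \<Rightarrow> complex) set" where
  "ell2 V = {f. (\<forall>v. v \<notin> V \<longrightarrow> f v = 0) \<and> (\<lambda>v. (cmod (f v))\<^sup>2) summable_on V}"

definition ell2_inner :: "'a set \<Rightarrow> ('a \<Rightarrow> complex) \<Rightarrow> ('a \<Rightarrow> complex) \<Rightarrow> complex" where
  "ell2_inner V f g = (\<Sum>\<^sub>\<infinity>v\<in>V. f v * cnj (g v))"

definition ell2_dist :: "'a set \<Rightarrow> ('a \<Rightarrow> complex) \<Rightarrow> ('a \<Rightarrow> complex) \<Rightarrow> real" where
  "ell2_dist V f g = sqrt (\<Sum>\<^sub>\<infinity>v\<in>V. (cmod (f v - g v))\<^sup>2)"

lemma ell2_finite_triangle:
  assumes "f \<in> ell2 V" "g \<in> ell2 V" "finite F" "F \<subseteq> V"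
  shows "sqrt (\<Sum>v\<in>F. (cmod (f v + g v))\<^sup>2)
    \<le> sqrt (\<Sum>\<^sub>\<infinity>v\<in>V. (cmod (f v))\<^sup>2) + sqrt (\<Sum>\<^sub>\<infinity>v\<in>V. (cmod (g v))\<^sup>2)"
proof -
  have le: "sqrt (\<Sum>v\<in>F. (cmod (h v))\<^sup>2) \<le> sqrt (\<Sum>\<^sub>\<infinity>v\<in>V. (cmod (h v))\<^sup>2)" if "h \<in> ell2 V" for h
    using that assms(3,4) by (auto simp: ell2_def intro!: finite_sum_le_infsum)
  have "sqrt (\<Sum>v\<in>F. (cmod (f v + g v))\<^sup>2) \<le> L2_set (\<lambda>v. cmod (f v) + cmod (g v)) F"
    unfolding L2_set_def by (intro real_sqrt_le_mono sum_mono power_mono norm_triangle_ineq) auto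
  also have "\<dots> \<le> L2_set (\<lambda>v. cmod (f v)) F + L2_set (\<lambda>v. cmod (g v)) F"
    by (rule L2_set_triangle_ineq)
  also have "\<dots> \<le> sqrt (\<Sum>\<^sub>\<infinity>v\<in>V. (cmod (f v))\<^sup>2) + sqrt (\<Sum>\<^sub>\<infinity>v\<in>V. (cmod (g v))\<^sup>2)"
    unfolding L2_set_def by (intro add_mono le assms)
  finally show ?thesis .
qed

lemma ell2_add_summable:
  assumes "f \<in> ell2 V" "g \<in> ell2 V"
  shows "(\<lambda>v. (cmod (f v + g v))\<^sup>2) summable_on V"
proof (rule nonneg_bdd_above_summable_on)
  define C where "C = sqrt (\<Sum>\<^sub>\<infinity>v\<in>V. (cmod (f v))\<^sup>2) + sqrt (\<Sum>\<^sub>\<infinity>v\<in>V. (cmod (g v))\<^sup>2)"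
  show "bdd_above (sum (\<lambda>v. (cmod (f v + g v))\<^sup>2) ` {F. F \<subseteq> V \<and> finite F})"
    by (rule bdd_aboveI2[where M = "C\<^sup>2"], rule sqrt_le_D)
       (use ell2_finite_triangle[OF assms] in \<open>auto simp: C_def\<close>)
qed simp

lemma ell2_triangle:
  assumes "f \<in> ell2 V" "g \<in> ell2 V"
  shows "sqrt (\<Sum>\<^sub>\<infinity>v\<in>V. (cmod (f v + g v))\<^sup>2)
    \<le> sqrt (\<Sum>\<^sub>\<infinity>v\<in>V. (cmod (f v))\<^sup>2) + sqrt (\<Sum>\<^sub>\<infinity>v\<in>V. (cmod (g v))\<^sup>2)" (is "_ \<le> ?C")
proof (rule real_le_lsqrt)
  show "(\<Sum>\<^sub>\<infinity>v\<in>V. (cmod (f v + g v))\<^sup>2) \<le> ?C\<^sup>2"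
    by (rule infsum_le_finite_sums[OF ell2_add_summable[OF assms]], rule sqrt_le_D)
       (use ell2_finite_triangle[OF assms] in auto)
qed (auto intro!: add_nonneg_nonneg infsum_nonneg)

lemma ell2_diff:
  assumes "f \<in> ell2 V" "g \<in> ell2 V"
  shows "(\<lambda>v. f v - g v) \<in> ell2 V"
proof -
  have "(\<lambda>v. - g v) \<in> ell2 V" using assms by (auto simp: ell2_def)
  from ell2_add_summable[OF assms(1) this] show ?thesis
    using assms by (auto simp: ell2_def)
qed

lemma Metric_space_ell2: "Metric_space (ell2 V) (ell2_dist V)"
proof
  fix f g h
  show "0 \<le> ell2_dist V f g" by (auto simp: ell2_dist_def intro!: infsum_nonneg)
  show "ell2_dist V f g = ell2_dist V g f" by (simp add: ell2_dist_def norm_minus_commute)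
  assume f: "f \<in> ell2 V" and g: "g \<in> ell2 V"
  show "ell2_dist V f g = 0 \<longleftrightarrow> f = g"
  proof
    assume "ell2_dist V f g = 0"
    then have s0: "(\<Sum>\<^sub>\<infinity>v\<in>V. (cmod (f v - g v))\<^sup>2) = 0" by (simp add: ell2_dist_def)
    have sm: "(\<lambda>v. (cmod (f v - g v))\<^sup>2) summable_on V"
      using ell2_diff[OF f g] by (simp add: ell2_def)
    have "(cmod (f v - g v))\<^sup>2 = 0" if "v \<in> V" for v
      by (rule nonneg_infsum_le_0D[OF _ sm _ that]) (use s0 in auto)
    then have "f v = g v" for v using f g by (cases "v \<in> V") (auto simp: ell2_def)
    then show "f = g" by blast
  qed (simp add: ell2_dist_def)
  assume h: "h \<in> ell2 V"
  show "ell2_dist V f h \<le> ell2_dist V f g + ell2_dist V g h"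
    using ell2_triangle[OF ell2_diff[OF f g] ell2_diff[OF g h]] by (simp add: ell2_dist_def)
qed

definition ell2_topology :: "'a set \<Rightarrow> ('a \<Rightarrow> complex) topology" where
  "ell2_topology V = Metric_space.mtopology (ell2 V) (ell2_dist V)"

text \<open>Sums of more than one summable family of squares, needed for the metric.\<close>

section \<open>Unbounded operators and Fredholm operators\<close>

text \<open>An operator in \<open>ell2 V\<close> is identified with its graph: its domain is \<open>Domain T\<close>, its range
  is \<open>Range T\<close>, and \<open>(f, g) \<in> T\<close> says that \<open>T f = g\<close>.\<close>

type_synonym 'a oper = "(('a \<Rightarrow> complex) \<times> ('a \<Rightarrow> complex)) set"

definition linear_oper :: "'a set \<Rightarrow> 'a oper \<Rightarrow> bool" where
  "linear_oper V T \<longleftrightarrow> T \<subseteq> ell2 V \<times> ell2 V \<and> single_valued T \<and> (0, 0) \<in> T \<and>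
     (\<forall>f g f' g'. (f, g) \<in> T \<longrightarrow> (f', g') \<in> T \<longrightarrow> (f + f', g + g') \<in> T) \<and>
     (\<forall>c f g. (f, g) \<in> T \<longrightarrow> ((\<lambda>v. c * f v), (\<lambda>v. c * g v)) \<in> T)"

definition closed_oper :: "'a set \<Rightarrow> 'a oper \<Rightarrow> bool" where
  "closed_oper V T \<longleftrightarrow> closedin (prod_topology (ell2_topology V) (ell2_topology V)) T"

definition densely_defined :: "'a set \<Rightarrow> 'a oper \<Rightarrow> bool" where
  "densely_defined V T \<longleftrightarrow> ell2_topology V closure_of Domain T = ell2 V"

definition kernel :: "'a oper \<Rightarrow> ('a \<Rightarrow> complex) set" where
  "kernel T = {f. (f, 0) \<in> T}"

text \<open>The graph of the adjoint; it is single-valued when \<open>T\<close> is densely defined.\<close>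

definition adjoint_oper :: "'a set \<Rightarrow> 'a oper \<Rightarrow> 'a oper" where
  "adjoint_oper V T = {(g, h). g \<in> ell2 V \<and> h \<in> ell2 V \<and>
     (\<forall>(f, Tf)\<in>T. ell2_inner V Tf g = ell2_inner V f h)}"

definition finite_dim :: "('a \<Rightarrow> complex) set \<Rightarrow> bool" where
  "finite_dim N \<longleftrightarrow> (\<exists>B. finite B \<and> N \<subseteq> cfun.span B)"

definition fredholm_oper :: "'a set \<Rightarrow> 'a oper \<Rightarrow> bool" where
  "fredholm_oper V T \<longleftrightarrow> linear_oper V T \<and> closed_oper V T \<and> densely_defined V T \<and>
     closedin (ell2_topology V) (Range T) \<and>
     finite_dim (kernel T) \<and> finite_dim (kernel (adjoint_oper V T))"

definition fredholm_index :: "'a set \<Rightarrow> 'a oper \<Rightarrow> int" where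
  "fredholm_index V T =
     int (cfun.dim (kernel T)) - int (cfun.dim (kernel (adjoint_oper V T)))"

section \<open>Weighted shifts\<close>

definition Lambda ::
  "'a set \<Rightarrow> ('a \<times> 'a) set \<Rightarrow> ('a \<Rightarrow> complex) \<Rightarrow> ('a \<Rightarrow> complex) \<Rightarrow> 'a \<Rightarrow> complex" where
  "Lambda V E w f v = (if v \<in> nonroots V E then w v * f (par E v) else 0)"

text \<open>Only the values of the weight function \<open>w\<close> on \<open>V\<degree>\<close> matter.\<close>

definition weighted_shift :: "'a set \<Rightarrow> ('a \<times> 'a) set \<Rightarrow> ('a \<Rightarrow> complex) \<Rightarrow> 'a oper" where
  "weighted_shift V E w = {(f, Lambda V E w f) |f. f \<in> ell2 V \<and> Lambda V E w f \<in> ell2 V}"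

end

theory Submission
  imports Defs
begin

text \<open>Let \<open>Z\<close> be the set of vertices all of whose children have weight \<open>0\<close>. The kernel of the
  weighted shift consists of the functions supported on \<open>Z\<close>; the kernel of its adjoint is
  orthogonal to every image of a basis vector, so its functions are determined by their values
  off a set containing one child with nonzero weight of each \<open>u \<notin> Z\<close>, and these values are
  free. Finiteness of the two dimensions thus bounds \<open>Z\<close> and the branching, and in the index the
  contributions of \<open>Z\<close> cancel except for the leaves.
  The index is at most \<open>1\<close> because the leaves lie in a finite set \<open>W\<close> of vertices closed under
  parents except at one common ancestor, so \<open>card W - 1\<close> is at most the total number of
  children of the nonleaves in \<open>W\<close>.\<close>

section \<open>Combinatorics of directed trees\<close>

context directed_tree
begin

section \<open>Parents and children\<close>

lemma edge_in: "(u, v) \<in> E \<Longrightarrow> u \<in> V \<and> v \<in> V"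
  using edges by auto

lemma edge_nonroot: "(u, v) \<in> E \<Longrightarrow> v \<in> nonroots V E"
  using edge_in by (auto simp: nonroots_def roots_def)

lemma parent_unique: "(u, v) \<in> E \<Longrightarrow> (u', v) \<in> E \<Longrightarrow> u = u'"
  using unique_parent[of v] edge_nonroot[of u v] by (auto simp: nonroots_def)

lemma par_eq: "(u, v) \<in> E \<Longrightarrow> par E v = u"
  unfolding par_def by (rule the_equality) (auto dest: parent_unique)

lemma par_edge:
  assumes "v \<in> nonroots V E"
  shows "(par E v, v) \<in> E"
  using unique_parent[of v] par_eq assms by (auto simp: nonroots_def)

lemma Chi_subset: "Chi E u \<subseteq> V"
  using edge_in by (auto simp: Chi_def)

lemma mem_Chi_iff: "v \<in> Chi E u \<longleftrightarrow> v \<in> nonroots V E \<and> par E v = u"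
  using edge_nonroot par_eq par_edge by (auto simp: Chi_def)

section \<open>Common ancestors\<close>

text \<open>By induction, prepending \<open>x\<close> to a path from \<open>y\<close>: if
  \<open>y\<close> is the parent of \<open>x\<close>, the ancestor \<open>z\<close> found for the
  tail still works. If \<open>x\<close> is the parent of \<open>y\<close>, the descent from
  \<open>z\<close> to \<open>y\<close> either is trivial or ends with the edge from
  \<open>x\<close>, since parents are unique.\<close>

lemma common_ancestor_path:
  assumes "successively (\<lambda>x y. (x, y) \<in> E \<or> (y, x) \<in> E) p" "p \<noteq> []"
  shows "\<exists>z. (z, hd p) \<in> E\<^sup>* \<and> (z, last p) \<in> E\<^sup>*"
  using assms
proof (induction p rule: induct_list012)
  case (3 x y zs)
  then obtain z where z: "(z, y) \<in> E\<^sup>*" "(z, last (y # zs)) \<in> E\<^sup>*"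
    by auto
  from 3 consider "(x, y) \<in> E" | "(y, x) \<in> E" by auto
  then show ?case
  proof cases
    case 1
    from z(1) show ?thesis
    proof (cases rule: rtrancl.cases)
      \<comment> \<open>Here \<open>z = y\<close>, and the common ancestor moves up to
        \<open>x\<close>.\<close>
      case rtrancl_refl
      then have "(x, last (y # zs)) \<in> E\<^sup>*"
        using z(2) 1 by (meson converse_rtrancl_into_rtrancl)
      then show ?thesis by auto
    next
      case (rtrancl_into_rtrancl b)
      then have "(z, x) \<in> E\<^sup>*" using 1 parent_unique by blast
      with z(2) show ?thesis by auto
    qed
  next
    case 2
    with z have "(z, x) \<in> E\<^sup>*" by auto
    with z(2) show ?thesis by auto
  qed
qed auto

lemma common_ancestor:
  assumes "u \<in> V" "v \<in> V"
  shows "\<exists>z. (z, u) \<in> E\<^sup>* \<and> (z, v) \<in> E\<^sup>*"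
proof (cases "u = v")
  case False
  from connected[OF assms False] obtain p where
    "length p \<ge> 2" "hd p = u" "last p = v" "successively (\<lambda>x y. (x, y) \<in> E \<or> (y, x) \<in> E) p"
    by blast
  then show ?thesis using common_ancestor_path[of p] by fastforce
qed auto

lemma ancestor_in: "(z, a) \<in> E\<^sup>* \<Longrightarrow> a \<in> V \<Longrightarrow> z \<in> V"
  by (induction rule: converse_rtrancl_induct) (auto dest: edge_in)

lemma common_ancestor_finite:
  assumes "finite A" "A \<subseteq> V"
  shows "\<exists>z\<in>V. \<forall>a\<in>A. (z, a) \<in> E\<^sup>*"
  using assms
proof (induction A)
  case empty
  then show ?case using nonempty by auto
next
  case (insert a A)
  then obtain z where z: "z \<in> V" "\<forall>a\<in>A. (z, a) \<in> E\<^sup>*" by auto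
  moreover obtain y where "(y, z) \<in> E\<^sup>*" "(y, a) \<in> E\<^sup>*"
    using common_ancestor[of z a] z insert.prems by auto
  ultimately show ?case
    using ancestor_in by (intro bexI[of _ y]) (auto intro: rtrancl_trans)
qed

text \<open>Nothing lies strictly above a root, so a common ancestor of two roots equals
  both.\<close>

lemma roots_eq_singleton:
  assumes "r \<in> roots V E"
  shows "roots V E = {r}"
proof -
  have "s = r" if s: "s \<in> roots V E" for s
  proof -
    obtain z where "(z, r) \<in> E\<^sup>*" "(z, s) \<in> E\<^sup>*"
      using common_ancestor[of r s] assms s by (auto simp: roots_def)
    then show ?thesis
      using assms s by (auto simp: roots_def elim: rtranclE)
  qed
  with assms show ?thesis by blast
qed

text \<open>\<open>W\<close> consists of the vertices on a descending path from \<open>z\<close> to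
  \<open>a\<close>.\<close>

lemma finite_path_set:
  assumes "(z, a) \<in> E\<^sup>*" "a \<in> V"
  shows "\<exists>W. finite W \<and> W \<subseteq> V \<and> a \<in> W \<and> z \<in> W \<and> (\<forall>x\<in>W - {z}. \<exists>y\<in>W. (y, x) \<in> E)"
  using assms
proof (induction rule: rtrancl_induct)
  case base
  then show ?case by (intro exI[of _ "{z}"]) auto
next
  case (step y a)
  then obtain W where "finite W" "W \<subseteq> V" "y \<in> W" "z \<in> W" "\<forall>x\<in>W - {z}. \<exists>y\<in>W. (y, x) \<in> E"
    using edge_in by blast
  with step show ?case by (intro exI[of _ "insert a W"]) auto
qed

text \<open>The union of descending paths from a common ancestor \<open>z\<close> to the points of
  \<open>A\<close>; inserting \<open>z\<close> separately covers empty \<open>A\<close>.\<close>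

lemma finite_ancestor_closed_set:
  assumes "finite A" "A \<subseteq> V"
  shows "\<exists>W z. finite W \<and> A \<subseteq> W \<and> W \<subseteq> V \<and> z \<in> W \<and> (\<forall>x\<in>W - {z}. \<exists>y\<in>W. (y, x) \<in> E)"
proof -
  obtain z where z: "z \<in> V" "\<forall>a\<in>A. (z, a) \<in> E\<^sup>*"
    using common_ancestor_finite[OF assms] by auto
  have "\<forall>a\<in>A. \<exists>W. finite W \<and> W \<subseteq> V \<and> a \<in> W \<and> z \<in> W \<and> (\<forall>x\<in>W - {z}. \<exists>y\<in>W. (y, x) \<in> E)"
    using finite_path_set z assms by blast
  then obtain W where W: "\<forall>a\<in>A. finite (W a) \<and> W a \<subseteq> V \<and> a \<in> W a \<and> z \<in> W a \<and>
      (\<forall>x\<in>W a - {z}. \<exists>y\<in>W a. (y, x) \<in> E)"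
    by metis
  then show ?thesis
    using z assms by (intro exI[of _ "insert z (\<Union>a\<in>A. W a)"] exI[of _ z]) blast
qed

section \<open>The index of a tree\<close>

text \<open>A nonleaf outside \<open>branching V E\<close> has exactly one child and contributes 0,
  so the summation set may be any convenient finite \<open>B\<close>.\<close>

lemma sum_branching_eq:
  assumes "fredholm_tree V E" "finite B" "branching V E \<subseteq> B" "B \<subseteq> nonleaves V E"
  shows "(\<Sum>u\<in>{u \<in> nonleaves V E. int (card (Chi E u)) - 1 \<noteq> 0}. int (card (Chi E u)) - 1) =
    (\<Sum>u\<in>B. int (card (Chi E u)) - 1)"
proof (rule sum.mono_neutral_left)
  show "{u \<in> nonleaves V E. int (card (Chi E u)) - 1 \<noteq> 0} \<subseteq> B"
  proof safe
    fix u assume u: "u \<in> nonleaves V E" "int (card (Chi E u)) - 1 \<noteq> 0"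
    then have "card (Chi E u) \<noteq> 0"
      using assms(1) by (auto simp: nonleaves_def fredholm_tree_def)
    then have "u \<in> branching V E" using u by (auto simp: branching_def nonleaves_def)
    then show "u \<in> B" using assms by auto
  qed
qed (use assms in auto)

theorem tree_index_le_1:
  assumes fred: "fredholm_tree V E" and fin: "finite (V - nonleaves V E)"
  shows "tree_index V E \<le> 1"
proof -
  obtain W z where W: "finite W" "V - nonleaves V E \<subseteq> W" "W \<subseteq> V" "z \<in> W"
      "\<forall>x\<in>W - {z}. \<exists>y\<in>W. (y, x) \<in> E"
    using finite_ancestor_closed_set[OF fin] by auto
  have finC: "finite (Chi E u)" if "u \<in> V" for u
    using fred that by (auto simp: fredholm_tree_def)
  define N where "N = W \<inter> nonleaves V E"
  have N: "finite N" using W by (auto simp: N_def)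
  \<comment> \<open>Each vertex of \<open>W\<close> other than \<open>z\<close> is a child of a
    vertex of \<open>W\<close>, which is then a nonleaf.\<close>
  have "card (W - {z}) \<le> card (\<Union>u\<in>N. Chi E u)"
    using W N by (intro card_mono) (fastforce simp: N_def nonleaves_def Chi_def intro!: finC)+
  also have "\<dots> \<le> (\<Sum>u\<in>N. card (Chi E u))"
    by (rule card_UN_le[OF N])
  finally have 1: "int (card W) - 1 \<le> (\<Sum>u\<in>N. int (card (Chi E u)))"
    using W by (simp add: card_Diff_singleton flip: of_nat_sum)
  have "W = N \<union> (V - nonleaves V E)" using W by (auto simp: N_def)
  then have 2: "card W = card N + card (V - nonleaves V E)"
    using N fin by (metis N_def card_Un_disjoint Diff_disjoint Int_Diff Int_commute Int_empty_right)
  define B where "B = N \<union> branching V E"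
  have B: "finite B" "branching V E \<subseteq> B" "B \<subseteq> nonleaves V E"
    using N fred by (auto simp: B_def N_def fredholm_tree_def branching_def nonleaves_def)
  \<comment> \<open>Passing from \<open>N\<close> to \<open>B\<close> captures all branching
    vertices; the added terms are nonnegative because they belong to nonleaves.\<close>
  have "(\<Sum>u\<in>N. int (card (Chi E u)) - 1) \<le> (\<Sum>u\<in>B. int (card (Chi E u)) - 1)"
  proof (rule sum_mono2)
    fix u assume "u \<in> B - N"
    with B(3) have "u \<in> V" "Chi E u \<noteq> {}" by (auto simp: nonleaves_def)
    with finC have "card (Chi E u) \<noteq> 0" by auto
    then show "0 \<le> int (card (Chi E u)) - 1" by linarith
  qed (use B in \<open>auto simp: B_def\<close>)
  with 1 2 show ?thesis
    unfolding tree_index_def sum_branching_eq[OF fred B] by (simp add: sum_subtractf)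
qed

end

section \<open>Dual families\<close>

lemma sum_fun_apply: "(\<Sum>i\<in>A. f i) x = (\<Sum>i\<in>A. f i x)"
  by (induction A rule: infinite_finite_induct) auto

text \<open>The vectors are indexed by points of their own domain, and evaluation at those points is
  the dual family: evaluating a vanishing combination at \<open>i\<close> isolates the coefficient
  of \<open>b i\<close>.\<close>

lemma cfun_dual_family_independent:
  fixes b :: "'a \<Rightarrow> 'a \<Rightarrow> complex"
  assumes dual: "\<And>i j. i \<in> I \<Longrightarrow> j \<in> I \<Longrightarrow> b i j = of_bool (i = j)"
  shows "inj_on b I" "cfun.independent (b ` I)"
proof -
  show inj: "inj_on b I"
  proof (rule inj_onI)
    fix i j assume "i \<in> I" "j \<in> I" "b i = b j"
    then have "b j i = 1" using dual[of i i] by simp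
    with dual[OF \<open>j \<in> I\<close> \<open>i \<in> I\<close>] show "i = j" by (cases "j = i") auto
  qed
  show "cfun.independent (b ` I)"
  proof (unfold cfun.independent_explicit_module, intro allI impI)
    fix s u v
    assume s: "finite s" "s \<subseteq> b ` I" "(\<Sum>f\<in>s. (\<lambda>x. u f * f x)) = 0" "v \<in> s"
    then obtain i where i: "i \<in> I" "v = b i" by auto
    have "(\<Sum>f\<in>s. u f * f i) = 0"
      using fun_cong[OF s(3), of i] by (simp add: sum_fun_apply)
    also have "(\<Sum>f\<in>s. u f * f i) = (\<Sum>f\<in>s. if f = v then u v else 0)"
    proof (rule sum.cong)
      fix f assume "f \<in> s"
      then obtain j where "j \<in> I" "f = b j" using s by auto
      moreover from this have "f = v \<longleftrightarrow> j = i"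
        using i inj_on_eq_iff[OF inj] by metis
      ultimately show "u f * f i = (if f = v then u v else 0)"
        using dual[of j i] i by simp
    qed simp
    finally show "u v = 0" using s by simp
  qed
qed

lemma finite_dim_dual_family:
  fixes b :: "'a \<Rightarrow> 'a \<Rightarrow> complex"
  assumes dual: "\<And>i j. i \<in> I \<Longrightarrow> j \<in> I \<Longrightarrow> b i j = of_bool (i = j)"
    and mem: "b ` I \<subseteq> K" and fin: "finite_dim K"
  shows "finite I"
proof -
  obtain B where "finite B" "K \<subseteq> cfun.span B" using fin by (auto simp: finite_dim_def)
  then have "finite (b ` I)"
    using cfun.independent_span_bound[of B "b ` I"] mem cfun_dual_family_independent[OF dual]
    by auto
  then show ?thesis
    using cfun_dual_family_independent(1)[OF dual] by (auto dest: finite_imageD)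
qed

text \<open>The values of \<open>f\<close> on \<open>I\<close> serve as its coordinates, so
  \<open>expand\<close> gives spanning and \<open>dual\<close> gives independence.\<close>

lemma dim_dual_family:
  fixes b :: "'a \<Rightarrow> 'a \<Rightarrow> complex"
  assumes dual: "\<And>i j. i \<in> I \<Longrightarrow> j \<in> I \<Longrightarrow> b i j = of_bool (i = j)"
    and mem: "b ` I \<subseteq> K"
    and expand: "\<And>f x. f \<in> K \<Longrightarrow> f x = (\<Sum>i\<in>I. f i * b i x)"
  shows "cfun.dim K = card I"
proof -
  have "K \<subseteq> cfun.span (b ` I)"
  proof
    fix f assume "f \<in> K"
    then have "f = (\<Sum>i\<in>I. (\<lambda>x. f i * b i x))"
      using expand by (auto simp: fun_eq_iff sum_fun_apply)
    also have "\<dots> \<in> cfun.span (b ` I)"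
      by (intro cfun.span_sum cfun.span_scale cfun.span_base) auto
    finally show "f \<in> cfun.span (b ` I)" .
  qed
  then have "card (b ` I) = cfun.dim K"
    using cfun.basis_card_eq_dim[OF mem] cfun_dual_family_independent[OF dual] by auto
  then show ?thesis
    using cfun_dual_family_independent(1)[OF dual] by (simp add: card_image)
qed

lemma ell2_finite_support:
  assumes "finite F" "F \<subseteq> V" "\<And>x. x \<notin> F \<Longrightarrow> f x = 0"
  shows "f \<in> ell2 V"
proof -
  have "(\<lambda>v. (cmod (f v))\<^sup>2) summable_on V \<longleftrightarrow> (\<lambda>v. (cmod (f v))\<^sup>2) summable_on F"
    by (rule summable_on_cong_neutral) (use assms in auto)
  then show ?thesis using assms by (auto simp: ell2_def)
qed

lemma ell2_inner_finite:
  assumes "finite F" "F \<subseteq> V" "\<And>x. x \<in> V - F \<Longrightarrow> f x * cnj (g x) = 0"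
  shows "ell2_inner V f g = (\<Sum>v\<in>F. f v * cnj (g v))"
proof -
  have "ell2_inner V f g = (\<Sum>\<^sub>\<infinity>v\<in>F. f v * cnj (g v))"
    unfolding ell2_inner_def by (rule infsum_cong_neutral) (use assms in auto)
  then show ?thesis using assms by simp
qed

section \<open>Kernels of a weighted shift and of its adjoint\<close>

locale weighted_tree = directed_tree V E for V :: "'a set" and E +
  fixes w :: "'a \<Rightarrow> complex"
begin

section \<open>Index sets for bases of the two kernels\<close>

text \<open>Leaves belong to this set vacuously.\<close>

definition null_vertices :: "'a set" where
  "null_vertices = {u \<in> V. \<forall>v\<in>Chi E u. w v = 0}"

text \<open>An arbitrary value at null vertices, where no child qualifies.\<close>

definition pivot :: "'a \<Rightarrow> 'a" where
  "pivot u = (SOME v. v \<in> Chi E u \<and> w v \<noteq> 0)"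

text \<open>The points at which a vector of the adjoint kernel can be prescribed; a root, if any, is
  among them.\<close>

definition free_vertices :: "'a set" where
  "free_vertices = V - pivot ` (V - null_vertices)"

text \<open>For \<open>v\<close> a child of \<open>u \<notin> null_vertices\<close>, the vector \<open>e\<^sub>v - cnj (w v / w c) e\<^sub>c\<close> with
  \<open>c = pivot u\<close>: the correction makes it orthogonal to the weights of the children of \<open>u\<close>.\<close>

definition coker_vector :: "'a \<Rightarrow> 'a \<Rightarrow> complex" where
  "coker_vector v x = (if x = v then 1
     else if v \<in> nonroots V E \<and> par E v \<notin> null_vertices \<and> x = pivot (par E v)
       then - cnj (w v / w x) else 0)"

lemma pivot:
  assumes "u \<in> V - null_vertices"
  shows "pivot u \<in> Chi E u" "w (pivot u) \<noteq> 0"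
proof -
  have "\<exists>v. v \<in> Chi E u \<and> w v \<noteq> 0"
    using assms by (auto simp: null_vertices_def)
  from someI_ex[OF this] show "pivot u \<in> Chi E u" "w (pivot u) \<noteq> 0"
    by (auto simp: pivot_def)
qed

text \<open>A vertex has only one parent, so \<open>v\<close> can be the pivot of no vertex other
  than \<open>u\<close>.\<close>

lemma mem_free_vertices_iff:
  assumes "v \<in> Chi E u"
  shows "v \<in> free_vertices \<longleftrightarrow> u \<in> null_vertices \<or> v \<noteq> pivot u"
proof -
  have "u = u'" if "v = pivot u'" "u' \<in> V - null_vertices" for u'
    using pivot(1)[OF that(2)] that(1) assms by (simp add: mem_Chi_iff)
  moreover have "u \<in> V" "v \<in> V"
    using assms edge_in by (auto simp: Chi_def)
  ultimately show ?thesis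
    by (auto simp: free_vertices_def)
qed

lemma Lambda_Chi: "v \<in> Chi E u \<Longrightarrow> Lambda V E w f v = w v * f u"
  by (simp add: Lambda_def mem_Chi_iff)

text \<open>A nonzero value of \<open>f\<close> at a vertex of \<open>V\<close> that is not null
  shows up in \<open>Lambda V E w f\<close> at the pivot. Below a null vertex all weights
  vanish.\<close>

lemma kernel_weighted_shift:
  "kernel (weighted_shift V E w) = {f \<in> ell2 V. \<forall>u. u \<notin> null_vertices \<longrightarrow> f u = 0}"
proof -
  have "Lambda V E w f = 0 \<longleftrightarrow> (\<forall>u. u \<notin> null_vertices \<longrightarrow> f u = 0)" if f: "f \<in> ell2 V" for f
  proof (intro iffI allI impI)
    fix u assume 0: "Lambda V E w f = 0" and u: "u \<notin> null_vertices"
    show "f u = 0"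
    proof (cases "u \<in> V")
      case True
      then show ?thesis
        using Lambda_Chi[OF pivot(1), of u f] pivot(2)[of u] 0 u by simp
    qed (use f in \<open>auto simp: ell2_def\<close>)
  next
    assume f0: "\<forall>u. u \<notin> null_vertices \<longrightarrow> f u = 0"
    have "w v * f (par E v) = 0" if "v \<in> nonroots V E" for v
      using that f0 by (cases "par E v \<in> null_vertices") (auto simp: null_vertices_def mem_Chi_iff)
    then show "Lambda V E w f = 0"
      by (auto simp: Lambda_def fun_eq_iff)
  qed
  moreover have "0 \<in> ell2 V" by (auto simp: ell2_def)
  moreover have "kernel (weighted_shift V E w) =
      {f. f \<in> ell2 V \<and> Lambda V E w f = 0 \<and> Lambda V E w f \<in> ell2 V}"
    by (auto simp: kernel_def weighted_shift_def)
  ultimately show ?thesis by (simp add: set_eq_iff) metis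
qed

lemma kernel_adjoint_weighted_shift:
  "g \<in> kernel (adjoint_oper V (weighted_shift V E w)) \<longleftrightarrow>
     g \<in> ell2 V \<and> (\<forall>f. f \<in> ell2 V \<longrightarrow> Lambda V E w f \<in> ell2 V \<longrightarrow> ell2_inner V (Lambda V E w f) g = 0)"
proof -
  have "0 \<in> ell2 V" by (auto simp: ell2_def)
  moreover have "ell2_inner V f 0 = 0" for f by (simp add: ell2_inner_def)
  ultimately show ?thesis
    by (auto simp: kernel_def adjoint_oper_def weighted_shift_def)
qed

text \<open>The correction term sits at a pivot, which is never a free vertex.\<close>

lemma coker_vector_dual:
  assumes "i \<in> free_vertices" "j \<in> free_vertices"
  shows "coker_vector i j = of_bool (i = j)"
proof -
  have False if "i \<in> nonroots V E" "par E i \<notin> null_vertices" "j = pivot (par E i)"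
  proof -
    have "par E i \<in> V" using par_edge[OF that(1)] edge_in by auto
    then show False using assms(2) that by (auto simp: free_vertices_def)
  qed
  then show ?thesis by (auto simp: coker_vector_def)
qed

lemma coker_vector_in_kernel:
  assumes v: "v \<in> free_vertices"
  shows "coker_vector v \<in> kernel (adjoint_oper V (weighted_shift V E w))"
proof -
  have vV: "v \<in> V" using v by (auto simp: free_vertices_def)
  show ?thesis
  proof (cases "v \<in> nonroots V E \<and> par E v \<notin> null_vertices")
    \<comment> \<open>Here \<open>v\<close> is a root or has weight 0, so every image vanishes at
      \<open>v\<close> and no correction occurs.\<close>
    case False
    then have b: "coker_vector v x = of_bool (x = v)" for x by (auto simp: coker_vector_def)
    have "Lambda V E w f v = 0" for f
      using False by (auto simp: Lambda_def null_vertices_def mem_Chi_iff dest: par_edge edge_in)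
    then have "ell2_inner V (Lambda V E w f) (coker_vector v) = 0" for f
      using ell2_inner_finite[of "{v}" V "Lambda V E w f" "coker_vector v"] vV b by simp
    moreover have "coker_vector v \<in> ell2 V"
      by (rule ell2_finite_support[of "{v}"]) (use vV b in auto)
    ultimately show ?thesis by (simp add: kernel_adjoint_weighted_shift)
  next
    case True
    define u where "u = par E v"
    define c where "c = pivot u"
    have vu: "v \<in> Chi E u" using True by (simp add: mem_Chi_iff u_def)
    have u: "u \<in> V - null_vertices" using True par_edge edge_in u_def by auto
    have c: "c \<in> Chi E u" "w c \<noteq> 0" using pivot[OF u] by (auto simp: c_def)
    have cV: "c \<in> V" using c Chi_subset by auto
    have cv: "c \<noteq> v" using v mem_free_vertices_iff[OF vu] u by (auto simp: c_def)
    have b: "coker_vector v x = (if x = v then 1 else if x = c then - cnj (w v / w c) else 0)" for x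
      using True by (auto simp: coker_vector_def u_def c_def)
    have "ell2_inner V (Lambda V E w f) (coker_vector v) = 0" for f
    proof -
      have "ell2_inner V (Lambda V E w f) (coker_vector v) =
          (\<Sum>x\<in>{v, c}. Lambda V E w f x * cnj (coker_vector v x))"
        by (rule ell2_inner_finite) (use vV cV b in auto)
      \<comment> \<open>\<open>v\<close> and \<open>c\<close> are siblings, so both values are
        multiples of \<open>f u\<close>, and the correction makes them cancel.\<close>
      also have "\<dots> = w v * f u - w c * f u * (w v / w c)"
        using cv b Lambda_Chi[OF vu, of f] Lambda_Chi[OF c(1), of f] by simp
      also have "\<dots> = 0" using c by simp
      finally show ?thesis .
    qed
    moreover have "coker_vector v \<in> ell2 V"
      by (rule ell2_finite_support[of "{v, c}"]) (use vV cV b in auto)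
    ultimately show ?thesis by (simp add: kernel_adjoint_weighted_shift)
  qed
qed

section \<open>Orthogonality relations among siblings\<close>

text \<open>Density gives some \<open>f\<close> in the domain near the basis vector at
  \<open>u\<close>. Then \<open>f u\<close> is nonzero, and on the children of \<open>u\<close> the
  image of \<open>f\<close> is \<open>f u\<close> times the weights.\<close>

lemma weights_square_summable:
  assumes dense: "densely_defined V (weighted_shift V E w)" and u: "u \<in> V"
  shows "(\<lambda>v. (cmod (w v))\<^sup>2) summable_on Chi E u"
proof -
  interpret M: Metric_space "ell2 V" "ell2_dist V" by (rule Metric_space_ell2)
  define e :: "'a \<Rightarrow> complex" where "e = (\<lambda>x. of_bool (x = u))"
  have e: "e \<in> ell2 V"
    by (rule ell2_finite_support[of "{u}"]) (use u in \<open>auto simp: e_def\<close>)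
  then have "e \<in> M.mtopology closure_of Domain (weighted_shift V E w)"
    using dense by (simp add: densely_defined_def ell2_topology_def)
  then obtain f where f: "f \<in> Domain (weighted_shift V E w)" "f \<in> M.mball e 1"
    unfolding M.metric_closure_of using zero_less_one by blast
  then have fl: "f \<in> ell2 V" "Lambda V E w f \<in> ell2 V" and d: "ell2_dist V e f < 1"
    by (auto simp: weighted_shift_def)
  \<comment> \<open>Otherwise the coordinate \<open>u\<close> alone would contribute 1 to the
    squared distance.\<close>
  have "f u \<noteq> 0"
  proof
    assume "f u = 0"
    then have "1 = (\<Sum>v\<in>{u}. (cmod (e v - f v))\<^sup>2)" by (simp add: e_def)
    also have "\<dots> \<le> (\<Sum>\<^sub>\<infinity>v\<in>V. (cmod (e v - f v))\<^sup>2)"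
      using ell2_diff[OF e fl(1)] u by (intro finite_sum_le_infsum) (auto simp: ell2_def)
    also have "\<dots> < 1" using d by (simp add: ell2_dist_def)
    finally show False by simp
  qed
  have "(\<lambda>v. (cmod (Lambda V E w f v))\<^sup>2) summable_on Chi E u"
    using fl(2) Chi_subset by (auto simp: ell2_def intro: summable_on_subset_banach)
  then have "(\<lambda>v. (cmod (w v))\<^sup>2 * (cmod (f u))\<^sup>2) summable_on Chi E u"
    by (rule summable_on_cong[THEN iffD1, rotated])
       (simp add: Lambda_Chi norm_mult power_mult_distrib)
  then show ?thesis
    using \<open>f u \<noteq> 0\<close> by (simp add: summable_on_cmult_left')
qed

text \<open>Square summability of the weights puts the basis vector at \<open>u\<close> in the
  domain; \<open>g\<close> is orthogonal to its image.\<close>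

lemma kernel_adjoint_orthogonal:
  assumes dense: "densely_defined V (weighted_shift V E w)" and u: "u \<in> V"
    and g: "g \<in> kernel (adjoint_oper V (weighted_shift V E w))"
  shows "(\<Sum>\<^sub>\<infinity>v\<in>Chi E u. w v * cnj (g v)) = 0"
proof -
  define e :: "'a \<Rightarrow> complex" where "e = (\<lambda>x. of_bool (x = u))"
  have e: "e \<in> ell2 V"
    by (rule ell2_finite_support[of "{u}"]) (use u in \<open>auto simp: e_def\<close>)
  have L: "Lambda V E w e v = (if v \<in> Chi E u then w v else 0)" for v
    by (auto simp: Lambda_def mem_Chi_iff e_def)
  have "(\<lambda>v. (cmod (Lambda V E w e v))\<^sup>2) summable_on V \<longleftrightarrow>
      (\<lambda>v. (cmod (w v))\<^sup>2) summable_on Chi E u"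
    by (rule summable_on_cong_neutral) (use Chi_subset in \<open>auto simp: L\<close>)
  then have "Lambda V E w e \<in> ell2 V"
    using weights_square_summable[OF dense u] Chi_subset by (auto simp: ell2_def L)
  then have "ell2_inner V (Lambda V E w e) g = 0"
    using g e by (auto simp: kernel_adjoint_weighted_shift)
  moreover have "ell2_inner V (Lambda V E w e) g = (\<Sum>\<^sub>\<infinity>v\<in>Chi E u. w v * cnj (g v))"
    unfolding ell2_inner_def by (rule infsum_cong_neutral) (use Chi_subset in \<open>auto simp: L\<close>)
  ultimately show ?thesis by simp
qed

section \<open>Finiteness and dimensions of the kernels\<close>

lemma unit_vector_in_kernel:
  assumes "u \<in> null_vertices"
  shows "(\<lambda>x. of_bool (u = x)) \<in> kernel (weighted_shift V E w)"
proof -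
  have "(\<lambda>x. of_bool (u = x)) \<in> ell2 V"
    by (rule ell2_finite_support[of "{u}"]) (use assms in \<open>auto simp: null_vertices_def\<close>)
  with assms show ?thesis by (auto simp: kernel_weighted_shift)
qed

lemma finite_null_vertices:
  assumes "finite_dim (kernel (weighted_shift V E w))"
  shows "finite null_vertices"
  by (rule finite_dim_dual_family[where b = "\<lambda>u x. of_bool (u = x)", OF refl _ assms])
     (auto intro: unit_vector_in_kernel)

lemma dim_kernel:
  assumes "finite null_vertices"
  shows "cfun.dim (kernel (weighted_shift V E w)) = card null_vertices"
proof (rule dim_dual_family[where b = "\<lambda>u x. of_bool (u = x)", OF refl])
  fix f x assume "f \<in> kernel (weighted_shift V E w)"
  then show "f x = (\<Sum>i\<in>null_vertices. f i * of_bool (i = x))"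
    using assms by (cases "x \<in> null_vertices")
      (auto simp: kernel_weighted_shift of_bool_def if_distrib cong: if_cong)
qed (use unit_vector_in_kernel in auto)

lemma finite_free_vertices:
  assumes "finite_dim (kernel (adjoint_oper V (weighted_shift V E w)))"
  shows "finite free_vertices"
  by (rule finite_dim_dual_family[OF coker_vector_dual _ assms])
     (auto intro: coker_vector_in_kernel)

text \<open>At most one child of \<open>u\<close>, the pivot, fails to be free.\<close>

lemma finite_Chi:
  assumes "finite free_vertices"
  shows "finite (Chi E u)"
proof -
  have "Chi E u \<subseteq> insert (pivot u) free_vertices"
    using mem_free_vertices_iff by blast
  then show ?thesis using assms finite_subset by blast
qed

text \<open>A branching vertex has a child other than its pivot. This child is free, so branching
  vertices are parents of free vertices.\<close>

lemma fredholm_tree_if_finite: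
  assumes fin: "finite free_vertices"
  shows "fredholm_tree V E"
proof -
  have "branching V E \<subseteq> par E ` free_vertices"
  proof
    fix u assume "u \<in> branching V E"
    then have "\<not> Chi E u \<subseteq> {pivot u}"
      using finite_Chi[OF fin] card_mono[of "{pivot u}" "Chi E u"]
      by (auto simp: branching_def)
    then show "u \<in> par E ` free_vertices"
      using mem_free_vertices_iff by (fastforce simp: mem_Chi_iff)
  qed
  then show ?thesis
    using fin finite_Chi[OF fin] by (auto simp: fredholm_tree_def intro: finite_subset)
qed

text \<open>For spanning, the orthogonality relation at \<open>u\<close> recovers the value of
  \<open>g\<close> at the pivot of \<open>u\<close> from its values at the siblings.\<close>

lemma dim_kernel_adjoint:
  assumes dense: "densely_defined V (weighted_shift V E w)" and fin: "finite free_vertices"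
  shows "cfun.dim (kernel (adjoint_oper V (weighted_shift V E w))) = card free_vertices"
proof (rule dim_dual_family[OF coker_vector_dual])
  fix g x assume g: "g \<in> kernel (adjoint_oper V (weighted_shift V E w))"
  then have gV: "g y = 0" if "y \<notin> V" for y
    using that by (auto simp: kernel_adjoint_weighted_shift ell2_def)
  show "g x = (\<Sum>i\<in>free_vertices. g i * coker_vector i x)"
  proof (cases "x \<in> free_vertices")
    case True
    then have "(\<Sum>i\<in>free_vertices. g i * coker_vector i x) =
        (\<Sum>i\<in>free_vertices. if i = x then g x else 0)"
      by (intro sum.cong) (auto simp: coker_vector_dual)
    with True fin show ?thesis by simp
  next
    case x: False
    show ?thesis
    proof (cases "x \<in> V")
      case False
      then have "coker_vector i x = 0" if "i \<in> free_vertices" for i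
        using coker_vector_in_kernel[OF that]
        by (auto simp: kernel_adjoint_weighted_shift ell2_def)
      with gV[OF False] show ?thesis by simp
    next
      case True
      with x obtain u where u: "u \<in> V - null_vertices" "x = pivot u"
        by (auto simp: free_vertices_def)
      have xu: "x \<in> Chi E u" "w x \<noteq> 0" using pivot[OF u(1)] u(2) by auto
      \<comment> \<open>Only the vectors of siblings of \<open>x\<close> can be nonzero at
        \<open>x\<close>, since \<open>x\<close> is a pivot of its parent alone.\<close>
      have "(\<Sum>i\<in>free_vertices. g i * coker_vector i x) =
          (\<Sum>i\<in>Chi E u - {x}. g i * - cnj (w i / w x))"
      proof (rule sum.mono_neutral_cong_right)
        show "Chi E u - {x} \<subseteq> free_vertices" using mem_free_vertices_iff u by auto
        show "\<forall>i\<in>free_vertices - (Chi E u - {x}). g i * coker_vector i x = 0"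
        proof
          fix i assume i: "i \<in> free_vertices - (Chi E u - {x})"
          have False if "i \<in> nonroots V E" "par E i \<notin> null_vertices" "x = pivot (par E i)"
          proof -
            have "par E i \<in> V - null_vertices"
              using par_edge[OF that(1)] edge_in that by auto
            then have "x \<in> Chi E (par E i)" using pivot(1) that(3) by simp
            then have "par E i = u" using xu(1) by (simp add: mem_Chi_iff)
            with i that(1) x show False by (auto simp: mem_Chi_iff)
          qed
          then show "g i * coker_vector i x = 0" using i x by (auto simp: coker_vector_def)
        qed
        fix i assume "i \<in> Chi E u - {x}"
        then show "g i * coker_vector i x = g i * - cnj (w i / w x)"
          using u by (auto simp: coker_vector_def mem_Chi_iff)
      qed (use fin in auto)
      also have "\<dots> = - cnj ((\<Sum>i\<in>Chi E u - {x}. w i * cnj (g i)) / w x)"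
        by (simp add: sum_divide_distrib sum_negf mult.commute)
      \<comment> \<open>The orthogonality relation, now a finite sum, is solved for its term at
        \<open>x\<close>.\<close>
      also have "(\<Sum>i\<in>Chi E u - {x}. w i * cnj (g i)) = - (w x * cnj (g x))"
        using kernel_adjoint_orthogonal[OF dense _ g, of u] u(1) xu(1) finite_Chi[OF fin, of u]
        by (simp add: sum.remove[of _ x] eq_neg_iff_add_eq_0 add.commute)
      finally show ?thesis using xu(2) by simp
    qed
  qed
qed (use coker_vector_in_kernel in auto)

section \<open>Counting free vertices and comparing the indices\<close>

text \<open>Besides a root, the free vertices are children of vertices in \<open>B\<close>: a null
  vertex keeps all its children, any other vertex of \<open>B\<close> loses exactly its
  pivot.\<close>

lemma card_free_vertices:
  assumes fin: "finite free_vertices" and B: "finite B" "B \<subseteq> nonleaves V E"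
    "branching V E \<subseteq> B" "null_vertices \<inter> nonleaves V E \<subseteq> B"
  shows "int (card free_vertices) = (if roots V E \<noteq> {} then 1 else 0) +
    (\<Sum>u\<in>B. int (card (Chi E u)) - 1 + of_bool (u \<in> null_vertices))"
proof -
  have rootsV: "roots V E \<subseteq> free_vertices"
  proof
    fix r assume r: "r \<in> roots V E"
    then have "r \<noteq> pivot u" if "u \<in> V - null_vertices" for u
      using pivot(1)[OF that] by (auto simp: roots_def Chi_def)
    with r show "r \<in> free_vertices" by (auto simp: free_vertices_def roots_def)
  qed
  have card_roots: "card (roots V E) = (if roots V E \<noteq> {} then 1 else 0)"
  proof (cases "roots V E = {}")
    case False
    then obtain r where "r \<in> roots V E" by auto
    from roots_eq_singleton[OF this] show ?thesis by simp
  qed simp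
  \<comment> \<open>A nonleaf outside \<open>B\<close> is not null and has its pivot as only child,
    so it has no free child.\<close>
  have "free_vertices - roots V E = (\<Union>u\<in>B. Chi E u \<inter> free_vertices)"
  proof (intro equalityI subsetI)
    fix v assume v: "v \<in> free_vertices - roots V E"
    then have "v \<in> nonroots V E" by (auto simp: free_vertices_def nonroots_def)
    then have vC: "v \<in> Chi E (par E v)" by (simp add: mem_Chi_iff)
    have uV: "par E v \<in> nonleaves V E"
      using vC edge_in by (auto simp: nonleaves_def Chi_def)
    have "par E v \<in> B"
    proof (cases "par E v \<in> null_vertices")
      case False
      then have "pivot (par E v) \<in> Chi E (par E v)" "v \<noteq> pivot (par E v)"
        using pivot(1) uV mem_free_vertices_iff[OF vC] v by (auto simp: nonleaves_def)
      then have "card {v, pivot (par E v)} \<le> card (Chi E (par E v))"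
        using vC finite_Chi[OF fin] by (intro card_mono) auto
      then have "par E v \<in> branching V E"
        using \<open>v \<noteq> _\<close> uV by (auto simp: branching_def nonleaves_def)
      with B show ?thesis by auto
    qed (use B uV in auto)
    with v vC show "v \<in> (\<Union>u\<in>B. Chi E u \<inter> free_vertices)" by auto
  qed (auto simp: mem_Chi_iff nonroots_def)
  moreover have "card (\<Union>u\<in>B. Chi E u \<inter> free_vertices) = (\<Sum>u\<in>B. card (Chi E u \<inter> free_vertices))"
    by (rule card_UN_disjoint) (use B fin in \<open>auto simp: mem_Chi_iff\<close>)
  moreover have "int (card (Chi E u \<inter> free_vertices)) =
      int (card (Chi E u)) - 1 + of_bool (u \<in> null_vertices)" if u: "u \<in> B" for u
  proof (cases "u \<in> null_vertices")
    case True
    then have "Chi E u \<inter> free_vertices = Chi E u" using mem_free_vertices_iff by auto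
    with True show ?thesis by simp
  next
    case False
    then have "Chi E u \<inter> free_vertices = Chi E u - {pivot u}" using mem_free_vertices_iff by auto
    moreover have p: "pivot u \<in> Chi E u" using False u B pivot(1) by (auto simp: nonleaves_def)
    moreover have "card (Chi E u) > 0" using p finite_Chi[OF fin] card_gt_0_iff by blast
    ultimately show ?thesis using False by (simp add: card_Diff_singleton of_nat_diff)
  qed
  moreover have "card free_vertices = card (roots V E) + card (free_vertices - roots V E)"
    using card_Un_disjoint[of "roots V E" "free_vertices - roots V E"] fin rootsV finite_subset
    by (metis Diff_disjoint Diff_partition finite_Diff)
  ultimately show ?thesis by (simp add: card_roots of_nat_sum)
qed

theorem fredholm_index_eq:
  assumes dense: "densely_defined V (weighted_shift V E w)"
    and finZ: "finite null_vertices" and fin: "finite free_vertices"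
  shows "fredholm_index V (weighted_shift V E w) = tree_index V E"
proof -
  define B where "B = branching V E \<union> (null_vertices \<inter> nonleaves V E)"
  have fred: "fredholm_tree V E" by (rule fredholm_tree_if_finite[OF fin])
  have B: "finite B" "B \<subseteq> nonleaves V E" "branching V E \<subseteq> B" "null_vertices \<inter> nonleaves V E \<subseteq> B"
    using fred finZ by (auto simp: B_def fredholm_tree_def branching_def nonleaves_def)
  \<comment> \<open>The nonleaf part of \<open>null_vertices\<close> cancels against the
    \<open>of_bool\<close> terms in the count of free vertices, leaving only the leaves.\<close>
  have "null_vertices = (V - nonleaves V E) \<union> (null_vertices \<inter> B)"
    using B by (auto simp: null_vertices_def nonleaves_def)
  then have "card null_vertices = card (V - nonleaves V E) + card (null_vertices \<inter> B)"
    using card_Un_disjoint[of "V - nonleaves V E" "null_vertices \<inter> B"] finZ B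
    by (metis finite_Un Diff_disjoint inf.absorb_iff1 inf.assoc inf.commute inf_bot_left)
  moreover have "(\<Sum>u\<in>B. of_bool (u \<in> null_vertices)) = int (card (null_vertices \<inter> B))"
    using B by (simp add: of_bool_def sum.If_cases Int_commute)
  ultimately show ?thesis
    unfolding fredholm_index_def tree_index_def sum_branching_eq[OF fred B(1,3,2)]
      dim_kernel[OF finZ] dim_kernel_adjoint[OF dense fin] card_free_vertices[OF fin B]
    by (simp add: sum.distrib)
qed

end

theorem theorem3p6p8:
  fixes V :: "'a set" and E :: "('a \<times> 'a) set" and w :: "'a \<Rightarrow> complex"
  assumes "directed_tree V E"
    and "fredholm_oper V (weighted_shift V E w)"
  shows "fredholm_tree V E \<and>
    fredholm_index V (weighted_shift V E w) = tree_index V E \<and> tree_index V E \<le> 1"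
proof -
  interpret weighted_tree V E w
    using assms(1) by (simp add: weighted_tree_def)
  have dense: "densely_defined V (weighted_shift V E w)"
    and finZ: "finite null_vertices" and fin: "finite free_vertices"
    using assms(2) finite_null_vertices finite_free_vertices by (auto simp: fredholm_oper_def)
  have "V - nonleaves V E \<subseteq> null_vertices"
    by (auto simp: nonleaves_def null_vertices_def)
  then have "finite (V - nonleaves V E)" using finZ finite_subset by blast
  then show ?thesis
    using fredholm_tree_if_finite[OF fin] fredholm_index_eq[OF dense finZ fin] tree_index_le_1
    by blast
qed

end
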